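(* Let $n\geqslant 3$ be an integer and let $q$ be a prime. Let $\vec{a}=(a_1,\ldots,a_n)\in\mathbb{Z}^n$ with $a_i\not\equiv 0\pmod q$ for all $i$, and let $\vec{h}=(h_1,\ldots,h_n)\in\mathbb{N}^n$ with $1\leqslant h_1\leqslant\cdots\leqslant h_n$. Then $$\#\mathcal{U}_{n,q}(\vec{a},\vec{h})\leqslant \left(\frac{h_1h_2h_3}{q}+\frac{h_2^3}{q}+h_2\right)\exp\left(O\left(\frac{\log q}{\log\log q}\right)\right),$$ where the implied constant depends only on $n$.
   Context: $\mathbb{F}_q$ is identified with $\{0,1,\ldots,q-1\}$, and $\|\zeta\|$ is the distance from a real $\zeta$ to the nearest integer. $\mathcal{U}_{n,q}(\vec{a},\vec{h})$ denotes the set of $u\in\mathbb{F}_q$ for which the Bohr set $\{s\in\mathbb{F}_q:\ \|a_j u^{j} s/q\|\leqslant h_j/q,\ j=1,\ldots,n\}$ contains some $s\neq 0$; equivalently, the set of $u\in\mathbb{F}_q$ for which there exist $s\in\{1,\ldots,q-1\}$ and integers $x_j$ with $|x_j|\leqslant h_j$ and $s a_j u^{j}\equiv x_j\pmod q$, $j=1,\ldots,n$. *)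

theory Defs
  imports "HOL-Analysis.Analysis" "HOL-Number_Theory.Number_Theory"
begin

definition nearest_int_dist :: "real \<Rightarrow> real" where
  "nearest_int_dist \<zeta> = infdist \<zeta> \<int>"

text \<open>The field with \<open>q\<close> elements is identified with \<open>{..<q}\<close>. Vectors indexed by
  \<open>1, \<dots>, n\<close> are functions on \<^typ>\<open>nat\<close> whose values outside \<open>{1..n}\<close> are never used.\<close>

definition bohr_set ::
  "nat \<Rightarrow> nat \<Rightarrow> (nat \<Rightarrow> int) \<Rightarrow> (nat \<Rightarrow> nat) \<Rightarrow> nat \<Rightarrow> nat set" where
  "bohr_set n q a h u =
     {s \<in> {..<q}. \<forall>j\<in>{1..n}.
        nearest_int_dist (of_int (a j * int u ^ j * int s) / real q) \<le> real (h j) / real q}"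

definition U_set ::
  "nat \<Rightarrow> nat \<Rightarrow> (nat \<Rightarrow> int) \<Rightarrow> (nat \<Rightarrow> nat) \<Rightarrow> nat set" where
  "U_set n q a h = {u \<in> {..<q}. \<exists>s\<in>bohr_set n q a h u. s \<noteq> 0}"

end

theory Submission
  imports Defs "HOL-Real_Asymp.Real_Asymp"
begin

text \<open>Let \<open>s\<close> witness that \<open>u \<noteq> 0\<close> is counted, and let \<open>x\<^sub>j\<close> be the absolutely least residue of
  \<open>s a\<^sub>j u\<^sup>j\<close> modulo \<open>q\<close>. Then \<open>u\<close> is determined by \<open>x\<^sub>1\<close> and \<open>x\<^sub>2\<close>, and
  \<open>a\<^sub>2\<^sup>2 x\<^sub>1 x\<^sub>3 \<equiv> a\<^sub>1 a\<^sub>3 x\<^sub>2\<^sup>2\<close>. For each of the \<open>2 h\<^sub>2\<close> values of \<open>x\<^sub>2\<close> this puts the product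
  \<open>x\<^sub>1 x\<^sub>3\<close> into one residue class, which leaves at most \<open>2 h\<^sub>1 h\<^sub>3 / q + 1\<close> possible values; as
  \<open>x\<^sub>1\<close> divides this nonzero product of size at most \<open>q\<^sup>2\<close>, the divisor bound finishes the count.\<close>

section \<open>The divisor bound\<close>

lemma card_divisors_mult_le:
  fixes a b :: nat
  assumes "a > 0" "b > 0"
  shows "card {d. d dvd a * b} \<le> card {d. d dvd a} * card {d. d dvd b}"
proof -
  have "{d. d dvd a * b} \<subseteq> (\<lambda>(x, y). x * y) ` ({d. d dvd a} \<times> {d. d dvd b})"
    by (force dest: division_decomp)
  then have "card {d. d dvd a * b} \<le> card ({d. d dvd a} \<times> {d. d dvd b})"
    using assms by (intro surj_card_le) auto
  then show ?thesis by (simp add: card_cartesian_product)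
qed

lemma card_divisors_prod_le:
  fixes f :: "'a \<Rightarrow> nat"
  assumes "finite A" "\<And>x. x \<in> A \<Longrightarrow> f x > 0"
  shows "card {d. d dvd prod f A} \<le> (\<Prod>x\<in>A. card {d. d dvd f x})"
  using assms
proof (induction A rule: finite_induct)
  case (insert x A)
  have "card {d. d dvd f x * prod f A} \<le> card {d. d dvd f x} * card {d. d dvd prod f A}"
    using insert by (intro card_divisors_mult_le) (auto intro!: prod_pos)
  also have "\<dots> \<le> card {d. d dvd f x} * (\<Prod>x\<in>A. card {d. d dvd f x})"
    using insert by (intro mult_left_mono) auto
  finally show ?case using insert by simp
qed simp

lemma card_divisors_prime_power:
  fixes p :: nat
  assumes "prime p"
  shows "card {d. d dvd p ^ e} = e + 1"
proof -
  have "{d. d dvd p ^ e} = (\<lambda>i. p ^ i) ` {..e}"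
    using assms by (auto simp: divides_primepow_nat le_imp_power_dvd)
  moreover have "inj_on (\<lambda>i. p ^ i) {..e}"
    using prime_gt_1_nat[OF assms] by (auto intro!: inj_onI)
  ultimately show ?thesis by (simp add: card_image)
qed

text \<open>A factor \<open>e + 1\<close> is at most \<open>2 ^ e\<close>, hence a small power of \<open>p ^ e\<close>, if \<open>p \<ge> y\<close>; there are
  at most \<open>y\<close> primes below \<open>y\<close>, and for these \<open>e + 1\<close> is bounded logarithmically.\<close>

lemma card_divisors_le_powr:
  fixes m :: nat and y :: real
  assumes m: "m > 0" and y: "y > 1"
  shows "real (card {d. d dvd m}) \<le>
           (1 + ln (real m) / ln 2) powr y * real m powr (ln 2 / ln y)"
proof -
  \<comment> \<open>\<open>K\<close> bounds every \<open>e p + 1\<close>, because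
    \<open>2 ^ e p\<close> divides into the estimate \<open>2 ^ e p \<le> p ^ e p \<le> m\<close>.
    The exponent \<open>\<delta>\<close> solves \<open>y powr \<delta> = 2\<close>, so
    \<open>p \<ge> y\<close> gives \<open>p powr \<delta> \<ge> 2\<close>.\<close>
  define K where "K = 1 + ln (real m) / ln 2"
  define \<delta> where "\<delta> = ln 2 / ln y"
  define P where "P = prime_factors m"
  define e where "e = (\<lambda>p. multiplicity p m)"
  have K: "K \<ge> 1" using m by (simp add: K_def)
  have \<delta>: "\<delta> > 0" using y by (simp add: \<delta>_def)
  have finP: "finite P" by (simp add: P_def)
  have pr: "prime p" if "p \<in> P" for p using that by (auto simp: P_def)
  have fac: "m = (\<Prod>p\<in>P. p ^ e p)"
    using m by (simp add: P_def e_def prime_factorization_nat)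
  have factor: "real (e p + 1) \<le> (if p < y then K else 1) * real (p ^ e p) powr \<delta>"
    if p: "p \<in> P" for p
  proof -
    have p2: "p \<ge> 2" using pr[OF p] prime_ge_2_nat by blast
    have ge1: "real (p ^ e p) \<ge> 1" using p2 by simp
    show ?thesis
    proof (cases "p < y")
      case True
      have "2 ^ e p \<le> p ^ e p" using p2 by (intro power_mono) auto
      also have "\<dots> \<le> m" using m by (intro dvd_imp_le) (auto simp: e_def multiplicity_dvd)
      finally have "(2::real) ^ e p \<le> real m"
        by (metis of_nat_le_iff of_nat_numeral of_nat_power)
      then have "ln ((2::real) ^ e p) \<le> ln (real m)" using m by (subst ln_le_cancel_iff) auto
      then have "real (e p) * ln 2 \<le> ln (real m)" by (simp add: ln_realpow)
      then have "real (e p + 1) \<le> K" by (simp add: K_def field_simps)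
      also have "\<dots> \<le> K * real (p ^ e p) powr \<delta>"
        using K ge1 \<delta> ge_one_powr_ge_zero[OF ge1, of \<delta>] by simp
      finally show ?thesis using True by simp
    next
      case False
      have "e p + 1 \<le> 2 ^ e p" by (metis Suc_eq_plus1 Suc_leI less_exp)
      then have "real (e p + 1) \<le> 2 ^ e p"
        by (metis of_nat_le_iff of_nat_numeral of_nat_power)
      also have "\<dots> = exp (real (e p) * ln 2)" by (simp add: exp_of_nat_mult)
      also have "\<dots> \<le> exp (\<delta> * (real (e p) * ln (real p)))"
      proof -
        have "ln y \<le> ln (real p)" using False y by simp
        then have "ln 2 \<le> \<delta> * ln (real p)"
          using y mult_left_mono[of "ln y" "ln p" \<delta>] \<delta> by (simp add: \<delta>_def)
        then have "real (e p) * ln 2 \<le> real (e p) * (\<delta> * ln (real p))"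
          by (intro mult_left_mono) auto
        then show ?thesis by (simp add: algebra_simps)
      qed
      also have "\<dots> = real (p ^ e p) powr \<delta>"
        using p2 by (simp add: powr_def ln_realpow)
      finally show ?thesis using False by simp
    qed
  qed
  have "card {d. d dvd m} \<le> (\<Prod>p\<in>P. card {d. d dvd p ^ e p})"
    by (subst fac, rule card_divisors_prod_le) (auto simp: finP dest!: pr intro: prime_gt_0_nat)
  also have "\<dots> = (\<Prod>p\<in>P. e p + 1)"
    by (intro prod.cong) (auto simp: card_divisors_prime_power pr)
  finally have "real (card {d. d dvd m}) \<le> (\<Prod>p\<in>P. real (e p + 1))"
    by (metis of_nat_le_iff of_nat_prod)
  also have "\<dots> \<le> (\<Prod>p\<in>P. (if p < y then K else 1) * real (p ^ e p) powr \<delta>)"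
    by (intro prod_mono conjI factor) auto
  also have "\<dots> = (\<Prod>p\<in>P. if p < y then K else 1) * (\<Prod>p\<in>P. real (p ^ e p) powr \<delta>)"
    by (rule prod.distrib)
  also have "(\<Prod>p\<in>P. real (p ^ e p) powr \<delta>) = real m powr \<delta>"
    by (subst fac) (simp add: prod_powr_distrib)
  also have "(\<Prod>p\<in>P. if p < y then K else 1) = K ^ card {p\<in>P. p < y}"
    by (simp add: prod.If_cases finP Int_def)
  also have "\<dots> = K powr real (card {p\<in>P. p < y})"
    using K by (simp add: powr_realpow)
  also have "\<dots> \<le> K powr y"
  proof (rule powr_mono)
    have "{p\<in>P. p < y} \<subseteq> {1..nat \<lfloor>y\<rfloor>}"
      using prime_gt_0_nat pr by (auto simp: Suc_le_eq le_nat_floor)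
    then have "card {p\<in>P. p < y} \<le> nat \<lfloor>y\<rfloor>"
      using card_mono[of "{1..nat \<lfloor>y\<rfloor>}" "{p\<in>P. p < y}"] by simp
    then show "real (card {p\<in>P. p < y}) \<le> y" using y by linarith
  qed (use K in auto)
  finally show ?thesis by (simp add: K_def \<delta>_def mult_right_mono)
qed

text \<open>This lower bound lets constant factors, and the small values of \<open>q\<close>, be
  absorbed into the exponential. The absolute value matters at \<open>q = 2\<close>, where
  \<open>ln (ln q)\<close> is negative.\<close>

lemma divide_ln_ln_ge_1:
  fixes q :: nat
  assumes "q \<ge> 2"
  shows "\<bar>ln (real q) / ln (ln (real q))\<bar> \<ge> 1"
proof -
  define x where "x = ln (real q)"
  have ln2: "ln (2::real) \<ge> 2 / 3" using ln2_ge_two_thirds by simp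
  have "ln 2 \<le> x" using assms by (simp add: x_def)
  then have x: "x \<ge> 2 / 3" using ln2 by simp
  \<comment> \<open>Division by zero yields 0 and would break the bound. The logarithm vanishes only
    for \<open>q = exp 1\<close>, which lies strictly between 2 and 3.\<close>
  have "ln x \<noteq> 0"
  proof
    assume "ln x = 0"
    then have "x = 1" using x by simp
    moreover have "exp x = real q" using assms by (simp add: x_def)
    ultimately have "exp 1 = real q" by simp
    moreover have "(2::real) < exp 1"
      using e_approx_32 by (simp add: abs_if split: if_splits)
    ultimately have "2 < q" "q < 3"
      using e_less_272 by linarith+
    then show False by simp
  qed
  \<comment> \<open>For the negative side,
    \<open>- ln x = ln (1 / x) \<le> 1 / x - 1 \<le> 1 / 2\<close>, which is below \<open>x\<close>
    since \<open>x \<ge> 2 / 3\<close>.\<close>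
  moreover have "\<bar>ln x\<bar> \<le> x"
  proof -
    have "ln (1 / x) \<le> 1 / x - 1" using x by (intro ln_le_minus_one) simp
    moreover have "1 / x \<le> 3 / 2" using x by (simp add: field_simps)
    moreover have "ln (1 / x) = - ln x" using x by (simp add: ln_div)
    moreover have "ln x \<le> x - 1" using x by (intro ln_le_minus_one) simp
    ultimately show ?thesis using x by linarith
  qed
  ultimately have "1 \<le> \<bar>x\<bar> / \<bar>ln x\<bar>" using x by simp
  then show ?thesis by (simp add: x_def)
qed

text \<open>With \<open>x = ln q\<close>, take \<open>y = sqrt x\<close> in
  \<open>card_divisors_le_powr\<close>: the small primes contribute
  \<open>sqrt x * ln (1 + 2 * x / ln 2)\<close> to the exponent, which is eventually below
  \<open>x / ln x\<close>, and the large ones at most \<open>4 * (x / ln x)\<close>. For bounded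
  \<open>x\<close> the trivial bound \<open>m\<close> suffices. The range up to
  \<open>q\<^sup>2\<close> accommodates a product of two residues.\<close>

lemma card_divisors_le_exp:
  "\<exists>C>0. \<forall>q m :: nat. q \<ge> 2 \<longrightarrow> 0 < m \<longrightarrow> m \<le> q\<^sup>2 \<longrightarrow>
     real (card {d. d dvd m}) \<le> exp (C * \<bar>ln (real q) / ln (ln (real q))\<bar>)"
proof -
  have "eventually (\<lambda>x::real. sqrt x * ln (1 + 2 * x / ln 2) \<le> x / ln x \<and> x > 1) at_top"
    by (intro eventually_conj) real_asymp+
  then obtain X where X: "\<And>x::real. x \<ge> X \<Longrightarrow> sqrt x * ln (1 + 2 * x / ln 2) \<le> x / ln x \<and> x > 1"
    by (auto simp: eventually_at_top_linorder)
  \<comment> \<open>For large \<open>x\<close> the two contributions add up to 1 + 4 = 5; for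
    \<open>x < X\<close> the trivial bound \<open>exp (2 * x)\<close> is at most
    \<open>exp (2 * X)\<close>.\<close>
  define C where "C = max 5 (2 * X)"
  have C: "C \<ge> 5" "C \<ge> 2 * X" by (auto simp: C_def)
  have "real (card {d. d dvd m}) \<le> exp (C * \<bar>ln (real q) / ln (ln (real q))\<bar>)"
    if q: "q \<ge> 2" and m: "0 < m" "m \<le> q\<^sup>2" for q m :: nat
  proof -
    define x where "x = ln (real q)"
    have xq: "real q = exp x" using q by (simp add: x_def)
    have "real m \<le> (real q)\<^sup>2" using m(2) by (metis of_nat_le_iff of_nat_power)
    then have mx: "real m \<le> exp (2 * x)" by (simp add: xq exp_double)
    then have lnm: "ln (real m) \<le> 2 * x" using m(1) by (metis ln_exp ln_le_cancel_iff exp_gt_zero of_nat_0_less_iff)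
    show ?thesis
    proof (cases "x \<ge> X")
      case True
      note * = X[OF True]
      define K where "K = 1 + ln (real m) / ln 2"
      have K: "K \<ge> 1" "K \<le> 1 + 2 * x / ln 2"
        using m(1) lnm by (auto simp: K_def field_simps)
      have "real (card {d. d dvd m}) \<le> K powr sqrt x * real m powr (ln 2 / ln (sqrt x))"
        unfolding K_def using * m by (intro card_divisors_le_powr) auto
      also have "\<dots> = exp (sqrt x * ln K + ln 2 / ln (sqrt x) * ln (real m))"
        using K m by (simp add: powr_def exp_add)
      also have "\<dots> \<le> exp (x / ln x + 4 * (x / ln x))"
      proof -
        have "sqrt x * ln K \<le> sqrt x * ln (1 + 2 * x / ln 2)"
          using K * by (intro mult_left_mono) auto
        then have 1: "sqrt x * ln K \<le> x / ln x" using * by linarith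
        have "ln 2 / ln (sqrt x) * ln (real m) \<le> 1 / ln (sqrt x) * (2 * x)"
          using * lnm m(1) ln_2_less_1 by (intro mult_mono divide_right_mono) auto
        also have "\<dots> = 4 * (x / ln x)" using * by (simp add: ln_sqrt)
        finally show ?thesis using 1 by simp
      qed
      also have "\<dots> \<le> exp (C * \<bar>x / ln x\<bar>)"
        using C * mult_right_mono[of 5 C "\<bar>x / ln x\<bar>"] by simp
      finally show ?thesis by (simp add: x_def)
    next
      case False
      have "{d. d dvd m} \<subseteq> {1..m}" using m by (auto dest: dvd_imp_le intro: Suc_leI dvd_pos_nat)
      then have "card {d. d dvd m} \<le> m" using card_mono[of "{1..m}"] by fastforce
      then have "real (card {d. d dvd m}) \<le> exp (2 * x)" using mx by linarith
      also have "\<dots> \<le> exp (C * 1)" using False C by simp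
      also have "\<dots> \<le> exp (C * \<bar>x / ln x\<bar>)"
        using C divide_ln_ln_ge_1[OF q] unfolding x_def exp_le_cancel_iff by (intro mult_left_mono) auto
      finally show ?thesis by (simp add: x_def)
    qed
  qed
  then show ?thesis using C by (intro exI[of _ C]) auto
qed

section \<open>Small residues and residue classes in an interval\<close>

lemma nearest_int_dist_ge: "\<bar>\<zeta> - of_int (round \<zeta>)\<bar> \<le> nearest_int_dist \<zeta>"
proof -
  have ne: "(\<int> :: real set) \<noteq> {}" by auto
  \<comment> \<open>The distance is an infimum over all integers, and rounding minimises the
    distance pointwise.\<close>
  show ?thesis
    unfolding nearest_int_dist_def infdist_notempty[OF ne]
    using ne by (rule cINF_greatest) (auto simp: dist_real_def round_diff_minimal elim!: Ints_cases)
qed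

lemma small_residue_exists:
  fixes q h :: nat and z :: int
  assumes q: "q > 0" and z: "nearest_int_dist (of_int z / real q) \<le> real h / real q"
  obtains x where "[z = x] (mod int q)" "\<bar>x\<bar> \<le> int h" "\<bar>x\<bar> \<le> int q"
proof
  define r where "r = round (real_of_int z / real q)"
  have eq: "real_of_int (z - int q * r) = real q * (of_int z / real q - of_int r)"
    using q by (simp add: field_simps)
  \<comment> \<open>Used twice: with \<open>k = h\<close> for the Bohr condition, and with
    \<open>k = q\<close> because the rounding error is at most 1/2. The second bound caps the
    residue even when \<open>h\<close> is large.\<close>
  have bound: "\<bar>z - int q * r\<bar> \<le> int k" if "\<bar>of_int z / real q - of_int r\<bar> \<le> real k / real q" for k
  proof -
    have "real_of_int \<bar>z - int q * r\<bar> = real q * \<bar>of_int z / real q - of_int r\<bar>"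
      by (simp only: of_int_abs eq abs_mult abs_of_nat)
    also have "\<dots> \<le> real q * (real k / real q)" by (intro mult_left_mono that) auto
    also have "\<dots> = real k" using q by simp
    finally show ?thesis by linarith
  qed
  show "[z = z - int q * r] (mod int q)" by (simp add: cong_iff_dvd_diff)
  show "\<bar>z - int q * r\<bar> \<le> int h"
    using nearest_int_dist_ge z bound unfolding r_def by (meson order_trans)
  have "\<bar>of_int z / real q - of_int r\<bar> \<le> 1 / 2"
    using of_int_round_abs_le[of "of_int z / real q"] by (simp add: r_def abs_minus_commute)
  then show "\<bar>z - int q * r\<bar> \<le> int q" by (intro bound) (use q in auto)
qed

text \<open>Members of one class are told apart by their quotients modulo \<open>q\<close>. After a
  shift by \<open>H\<close> into \<open>{0..2 * H}\<close>, these quotients range over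
  \<open>{0..2 * H div q}\<close>.\<close>

lemma card_residue_class_le:
  fixes q H :: nat and T :: "int set"
  assumes q: "q > 0" and T: "T \<subseteq> {- int H..int H}"
    and cong: "\<And>s t. s \<in> T \<Longrightarrow> t \<in> T \<Longrightarrow> [s = t] (mod int q)"
  shows "real (card T) \<le> 2 * real H / real q + 1"
proof -
  define f where "f = (\<lambda>t. (t + int H) div int q)"
  have "inj_on f T"
  proof
    fix s t assume st: "s \<in> T" "t \<in> T" "f s = f t"
    have "(s + int H) mod int q = (t + int H) mod int q"
      using cong[OF st(1,2)] by (metis cong_add_rcancel cong_def)
    then show "s = t" using st(3) unfolding f_def
      by (metis add_right_cancel div_mult_mod_eq)
  qed
  moreover have "f ` T \<subseteq> {0..int (2 * H) div int q}"
    using q T by (auto simp: f_def pos_imp_zdiv_nonneg_iff intro!: zdiv_mono1 dest!: subsetD)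
  ultimately have "card T \<le> card {0..int (2 * H) div int q}"
    by (intro card_inj_on_le) auto
  also have "\<dots> = (2 * H) div q + 1" by (simp flip: of_nat_mult zdiv_int add: nat_add_distrib)
  finally have "real (card T) \<le> real ((2 * H) div q) + 1" by linarith
  also have "real ((2 * H) div q) \<le> real (2 * H) / real q" by (rule of_nat_div_le_of_nat)
  finally show ?thesis by simp
qed

lemma card_int_divisors:
  fixes t :: int
  assumes "t \<noteq> 0"
  shows "finite {d. d dvd t}" "card {d. d dvd t} \<le> 2 * card {d. d dvd nat \<bar>t\<bar>}"
proof -
  let ?D = "{d. d dvd nat \<bar>t\<bar>}"
  have sub: "{d. d dvd t} \<subseteq> int ` ?D \<union> (\<lambda>d. - int d) ` ?D"
  proof
    fix d assume "d \<in> {d. d dvd t}"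
    then have "nat \<bar>d\<bar> \<in> ?D" by (simp add: nat_abs_dvd_iff)
    moreover have "d = int (nat \<bar>d\<bar>) \<or> d = - int (nat \<bar>d\<bar>)" by auto
    ultimately show "d \<in> int ` ?D \<union> (\<lambda>d. - int d) ` ?D" by blast
  qed
  have fin: "finite ?D" using assms by (intro finite_divisors_nat) simp
  then show "finite {d. d dvd t}" using sub finite_subset by blast
  have "card {d. d dvd t} \<le> card (int ` ?D \<union> (\<lambda>d. - int d) ` ?D)"
    using sub fin by (intro card_mono) auto
  also have "\<dots> \<le> card (int ` ?D) + card ((\<lambda>d. - int d) ` ?D)" by (rule card_Un_le)
  also have "\<dots> \<le> card ?D + card ?D" by (intro add_mono card_image_le fin)
  finally show "card {d. d dvd t} \<le> 2 * card ?D" by simp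
qed

section \<open>Counting the elements of \<open>U_set\<close>\<close>

lemma U_set_residues:
  assumes n: "n \<ge> 3" and q: "prime q" and a: "\<And>i. i \<in> {1..n} \<Longrightarrow> \<not> int q dvd a i"
    and u: "u \<in> U_set n q a h" "u \<noteq> 0"
  obtains x1 x2 x3 where "x1 \<noteq> 0" "x2 \<noteq> 0" "x3 \<noteq> 0" "\<not> int q dvd x1"
    "\<bar>x1\<bar> \<le> int (h 1)" "\<bar>x2\<bar> \<le> int (h 2)" "\<bar>x3\<bar> \<le> int (h 3)"
    "\<bar>x1\<bar> \<le> int q" "\<bar>x3\<bar> \<le> int q"
    "[a 1 * x2 = int u * (a 2 * x1)] (mod int q)"
    "[(a 2)\<^sup>2 * (x1 * x3) = a 1 * a 3 * x2\<^sup>2] (mod int q)"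
proof -
  obtain s where s: "s < q" "s \<noteq> 0" and uq: "u < q"
    and bohr: "\<And>j. j \<in> {1..n} \<Longrightarrow>
      nearest_int_dist (of_int (a j * int u ^ j * int s) / real q) \<le> real (h j) / real q"
    using u(1) by (auto simp: U_set_def bohr_set_def)
  have q0: "q > 0" using q prime_gt_0_nat by blast
  have pq: "prime (int q)" using q by simp
  have ndvd: "\<not> int q dvd int k" if "k < q" "k \<noteq> 0" for k
    using that by (auto dest: zdvd_imp_le)
  have "\<exists>x. [a j * int u ^ j * int s = x] (mod int q) \<and> \<bar>x\<bar> \<le> int (h j) \<and> \<bar>x\<bar> \<le> int q
          \<and> \<not> int q dvd x" if j: "j \<in> {1..n}" for j
  proof -
    obtain x where x: "[a j * int u ^ j * int s = x] (mod int q)" "\<bar>x\<bar> \<le> int (h j)" "\<bar>x\<bar> \<le> int q"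
      using small_residue_exists[OF q0 bohr[OF j]] by blast
    \<comment> \<open>The prime \<open>q\<close> divides none of \<open>a j\<close>,
      \<open>u\<close>, \<open>s\<close>; this is where \<open>u \<noteq> 0\<close> enters.\<close>
    have "\<not> int q dvd a j * int u ^ j * int s"
      using a[OF j] ndvd[OF s] ndvd[OF uq u(2)] pq
      unfolding prime_dvd_mult_iff[OF pq] by (blast dest: prime_dvd_power)
    then show ?thesis using x cong_dvd_iff by blast
  qed
  then obtain x where x: "\<And>j. j \<in> {1..n} \<Longrightarrow> [a j * int u ^ j * int s = x j] (mod int q)"
    "\<And>j. j \<in> {1..n} \<Longrightarrow> \<bar>x j\<bar> \<le> int (h j)" "\<And>j. j \<in> {1..n} \<Longrightarrow> \<bar>x j\<bar> \<le> int q"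
    "\<And>j. j \<in> {1..n} \<Longrightarrow> \<not> int q dvd x j"
    by metis
  have mem: "1 \<in> {1..n}" "2 \<in> {1..n}" "3 \<in> {1..n}" using n by auto
  note c = x(1)[OF mem(1)] x(1)[OF mem(2)] x(1)[OF mem(3)]
  \<comment> \<open>Both sides are congruent to \<open>a 1 * a 2 * u ^ 2 * s\<close>, so
    \<open>s\<close> is eliminated.\<close>
  have "[a 1 * x 2 = a 1 * (a 2 * int u ^ 2 * int s)] (mod int q)"
    by (intro cong_mult cong_refl cong_sym[OF c(2)])
  also have "a 1 * (a 2 * int u ^ 2 * int s) = int u * (a 2 * (a 1 * int u ^ 1 * int s))"
    by (simp add: power2_eq_square)
  also have "[\<dots> = int u * (a 2 * x 1)] (mod int q)"
    by (intro cong_mult cong_refl c(1))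
  finally have 1: "[a 1 * x 2 = int u * (a 2 * x 1)] (mod int q)" .
  \<comment> \<open>Here the common value is
    \<open>a 1 * (a 2)\<^sup>2 * a 3 * u ^ 4 * s\<^sup>2\<close>, as 1 + 3 = 2 + 2.\<close>
  have "[(a 2)\<^sup>2 * (x 1 * x 3)
        = (a 2)\<^sup>2 * ((a 1 * int u ^ 1 * int s) * (a 3 * int u ^ 3 * int s))] (mod int q)"
    by (intro cong_mult cong_refl cong_sym[OF c(1)] cong_sym[OF c(3)])
  also have "(a 2)\<^sup>2 * ((a 1 * int u ^ 1 * int s) * (a 3 * int u ^ 3 * int s))
        = a 1 * a 3 * (a 2 * int u ^ 2 * int s)\<^sup>2"
    by (simp add: power2_eq_square power3_eq_cube)
  also have "[\<dots> = a 1 * a 3 * (x 2)\<^sup>2] (mod int q)"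
    by (intro cong_mult cong_refl cong_pow c(2))
  finally have 2: "[(a 2)\<^sup>2 * (x 1 * x 3) = a 1 * a 3 * (x 2)\<^sup>2] (mod int q)" .
  have nz: "x j \<noteq> 0" if "j \<in> {1..n}" for j using x(4)[OF that] by auto
  show thesis
    by (rule that[of "x 1" "x 2" "x 3"]) (use 1 2 nz mem x in auto)
qed

text \<open>The leading 1 pays for \<open>u = 0\<close>. The other \<open>u\<close> inject into
  triples \<open>(x2, x1 * x3, x1)\<close>; the three factors count the nonzero \<open>x2\<close>,
  the products in one residue class, and the divisors of either sign.\<close>

lemma card_U_set_le:
  fixes D :: real
  assumes n: "n \<ge> 3" and q: "prime q" and a: "\<And>i. i \<in> {1..n} \<Longrightarrow> \<not> int q dvd a i"
    and D: "\<And>m. 0 < m \<Longrightarrow> m \<le> q\<^sup>2 \<Longrightarrow> real (card {d. d dvd m}) \<le> D"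
  shows "real (card (U_set n q a h)) \<le>
    1 + 2 * real (h 2) * (2 * (real (h 1) * real (h 3)) / real q + 1) * (2 * D)"
proof -
  define Q where "Q = int q"
  define H where "H = h 1 * h 3"
  define Y where "Y = {- int (h 2)..int (h 2)} - {0}"
  \<comment> \<open>Candidates for the product \<open>x1 * x3\<close> when \<open>x2 = y\<close>.
    Being nonzero keeps the number of divisors finite, and the cap \<open>Q\<^sup>2\<close> makes
    the bound \<open>D\<close> applicable.\<close>
  define T where "T = (\<lambda>y. {t \<in> {- int H..int H}. t \<noteq> 0 \<and> \<bar>t\<bar> \<le> Q\<^sup>2
     \<and> [(a 2)\<^sup>2 * t = a 1 * a 3 * y\<^sup>2] (mod Q)})"
  define S where "S = (SIGMA y:Y. SIGMA t:T y. {d. d dvd t})"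
  have q0: "q > 0" using q prime_gt_0_nat by blast
  have pQ: "prime Q" using q by (simp add: Q_def)
  have a2: "\<not> Q dvd a 2" using a n by (simp add: Q_def)
  have finT: "finite (T y)" for y by (rule finite_subset[of _ "{- int H..int H}"]) (auto simp: T_def)
  have finY: "finite Y" by (simp add: Y_def)
  have cardY: "real (card Y) = 2 * real (h 2)" by (simp add: Y_def)
  have cardT: "real (card (T y)) \<le> 2 * real H / real q + 1" for y
  proof (rule card_residue_class_le[OF q0])
    show "T y \<subseteq> {- int H..int H}" by (auto simp: T_def)
    fix s t assume "s \<in> T y" "t \<in> T y"
    \<comment> \<open>Since \<open>a 2\<close> is invertible modulo \<open>Q\<close>, the defining
      congruence confines \<open>T y\<close> to a single class.\<close>
    then have "[(a 2)\<^sup>2 * s = (a 2)\<^sup>2 * t] (mod Q)"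
      unfolding T_def by (auto intro: cong_trans cong_sym)
    moreover have "coprime ((a 2)\<^sup>2) Q"
      using pQ a2 by (simp add: coprime_commute prime_imp_coprime)
    ultimately show "[s = t] (mod int q)" by (simp add: cong_mult_lcancel Q_def)
  qed
  have finD: "finite {d. d dvd t}" and cardD: "real (card {d. d dvd t}) \<le> 2 * D"
    if "t \<in> T y" for t y
  proof -
    have t: "t \<noteq> 0" "\<bar>t\<bar> \<le> Q\<^sup>2" using that by (auto simp: T_def)
    show "finite {d. d dvd t}" using card_int_divisors t by blast
    have "nat \<bar>t\<bar> \<le> q\<^sup>2" using t(2) by (simp add: Q_def nat_le_iff)
    then have "real (card {d. d dvd nat \<bar>t\<bar>}) \<le> D" using t by (intro D) auto
    then show "real (card {d. d dvd t}) \<le> 2 * D" using card_int_divisors(2)[OF t(1)] by linarith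
  qed
  \<comment> \<open>The sign of \<open>D\<close> is read off from its instance at
    \<open>m = 1\<close>.\<close>
  have D0: "D \<ge> 0" using D[of 1] q0 by (simp add: order_trans[rotated])
  have "real (card S) = (\<Sum>y\<in>Y. \<Sum>t\<in>T y. real (card {d. d dvd t}))"
    unfolding S_def using finD finT finY by (subst card_SigmaI) (auto simp: card_SigmaI)
  also have "\<dots> \<le> (\<Sum>y\<in>Y. \<Sum>t\<in>T y. 2 * D)"
    by (intro sum_mono cardD)
  also have "\<dots> = (\<Sum>y\<in>Y. real (card (T y)) * (2 * D))" by simp
  also have "\<dots> \<le> (\<Sum>y\<in>Y. (2 * real H / real q + 1) * (2 * D))"
    using D0 cardT by (intro sum_mono mult_right_mono) auto
  also have "\<dots> = 2 * real (h 2) * (2 * real H / real q + 1) * (2 * D)"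
    by (simp add: cardY)
  finally have cardS: "real (card S) \<le> 2 * real (h 2) * (2 * real H / real q + 1) * (2 * D)" .
  have finS: "finite S" unfolding S_def using finY finT finD by (intro finite_SigmaI) auto

  \<comment> \<open>The triple depends on the chosen \<open>s\<close>, so it is picked from a
    relation; the last two conjuncts retain what is needed to recover \<open>u\<close>.\<close>
  define P where "P = (\<lambda>u (y, t, d). (y, t, d) \<in> S \<and> \<not> Q dvd d
    \<and> [a 1 * y = int u * (a 2 * d)] (mod Q))"
  have "\<exists>w. P u w"
    if u: "u \<in> U_set n q a h - {0}" for u
  proof -
    have u': "u \<in> U_set n q a h" "u \<noteq> 0" using u by auto
    obtain x1 x2 x3 where x: "x1 \<noteq> 0" "x2 \<noteq> 0" "x3 \<noteq> 0" "\<not> int q dvd x1"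
      "\<bar>x1\<bar> \<le> int (h 1)" "\<bar>x2\<bar> \<le> int (h 2)" "\<bar>x3\<bar> \<le> int (h 3)"
      "\<bar>x1\<bar> \<le> int q" "\<bar>x3\<bar> \<le> int q"
      "[a 1 * x2 = int u * (a 2 * x1)] (mod int q)"
      "[(a 2)\<^sup>2 * (x1 * x3) = a 1 * a 3 * x2\<^sup>2] (mod int q)"
      by (rule U_set_residues[OF n q a u'])
    have "\<bar>x1 * x3\<bar> \<le> int H" unfolding abs_mult H_def of_nat_mult by (intro mult_mono x) auto
    moreover have "\<bar>x1 * x3\<bar> \<le> Q\<^sup>2"
      unfolding abs_mult Q_def power2_eq_square by (intro mult_mono x) auto
    ultimately have "(x2, x1 * x3, x1) \<in> S"
      using x unfolding S_def Y_def T_def Q_def by auto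
    then have "P u (x2, x1 * x3, x1)" using x by (simp add: P_def Q_def)
    then show ?thesis ..
  qed
  then obtain w where w: "\<And>u. u \<in> U_set n q a h - {0} \<Longrightarrow> P u (w u)"
    by metis
  have "inj_on w (U_set n q a h - {0})"
  proof
    fix u v assume u: "u \<in> U_set n q a h - {0}" and v: "v \<in> U_set n q a h - {0}" and eq: "w u = w v"
    obtain y t d where ytd: "w u = (y, t, d)" by (cases "w u") auto
    have d: "\<not> Q dvd d" and "[a 1 * y = int u * (a 2 * d)] (mod Q)"
      "[a 1 * y = int v * (a 2 * d)] (mod Q)"
      using w[OF u] w[OF v] ytd eq by (simp_all add: P_def)
    \<comment> \<open>Equal triples give the same \<open>a 1 * y\<close>; cancelling the invertible
      \<open>a 2 * d\<close> leaves \<open>u\<close> and \<open>v\<close> congruent, and both are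
      below \<open>q\<close>.\<close>
    then have "[int u * (a 2 * d) = int v * (a 2 * d)] (mod Q)"
      by (meson cong_sym cong_trans)
    moreover have "coprime (a 2 * d) Q"
      using pQ a2 d by (simp add: coprime_commute prime_imp_coprime)
    ultimately have "[u = v] (mod q)" by (simp add: cong_mult_rcancel Q_def cong_int_iff)
    moreover have "u < q" "v < q" using u v by (auto simp: U_set_def)
    ultimately show "u = v" by (simp add: cong_less_modulus_unique_nat)
  qed
  then have "card (U_set n q a h - {0}) \<le> card S"
    using finS by (intro card_inj_on_le[of w]) (auto simp: P_def dest!: w)
  moreover have "finite (U_set n q a h)" by (simp add: U_set_def)
  then have "card (U_set n q a h) \<le> 1 + card (U_set n q a h - {0})"
    using card_Diff1_le by (cases "0 \<in> U_set n q a h") (auto simp: card_Diff_singleton)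
  ultimately show ?thesis using cardS unfolding H_def by simp
qed

theorem theorem2p2:
  fixes n :: nat
  assumes "n \<ge> 3"
  shows "\<exists>C>0. \<forall>(q::nat) (a::nat \<Rightarrow> int) (h::nat \<Rightarrow> nat).
     prime q \<longrightarrow>
     (\<forall>i\<in>{1..n}. \<not> [a i = 0] (mod int q)) \<longrightarrow>
     1 \<le> h 1 \<longrightarrow> mono_on {1..n} h \<longrightarrow>
     real (card (U_set n q a h)) \<le>
       (real (h 1) * real (h 2) * real (h 3) / real q + real (h 2) ^ 3 / real q + real (h 2))
         * exp (C * \<bar>ln (real q) / ln (ln (real q))\<bar>)"
proof -
  obtain C where C: "C > 0" and D: "\<And>q m :: nat. q \<ge> 2 \<Longrightarrow> 0 < m \<Longrightarrow> m \<le> q\<^sup>2 \<Longrightarrow>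
     real (card {d. d dvd m}) \<le> exp (C * \<bar>ln (real q) / ln (ln (real q))\<bar>)"
    using card_divisors_le_exp by blast
  have "real (card (U_set n q a h)) \<le>
       (real (h 1) * real (h 2) * real (h 3) / real q + real (h 2) ^ 3 / real q + real (h 2))
         * exp ((C + 8) * \<bar>ln (real q) / ln (ln (real q))\<bar>)"
    if q: "prime q" and a: "\<forall>i\<in>{1..n}. \<not> [a i = 0] (mod int q)"
      and h: "1 \<le> h 1" "mono_on {1..n} h" for q :: nat and a h
  proof -
    define R where "R = \<bar>ln (real q) / ln (ln (real q))\<bar>"
    define M where "M = real (h 1) * real (h 2) * real (h 3) / real q"
    have q2: "q \<ge> 2" using q prime_ge_2_nat by blast
    have R: "R \<ge> 1" unfolding R_def by (rule divide_ln_ln_ge_1[OF q2])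
    have M: "M \<ge> 0" by (simp add: M_def)
    have "h 1 \<le> h 2" using h(2) assms by (auto simp: mono_on_def)
    then have h2: "real (h 2) \<ge> 1" using h(1) by simp
    have E: "exp (C * R) \<ge> 1" using C R by simp
    have "real (card (U_set n q a h)) \<le>
      1 + 2 * real (h 2) * (2 * (real (h 1) * real (h 3)) / real q + 1) * (2 * exp (C * R))"
      using a unfolding R_def cong_0_iff by (intro card_U_set_le assms q D q2) auto
    also have "\<dots> = 1 + (8 * M + 4 * real (h 2)) * exp (C * R)"
      by (simp add: M_def algebra_simps add_divide_distrib)
    \<comment> \<open>The 1 coming from \<open>u = 0\<close> is absorbed, since \<open>h 2\<close>
      and the exponential are both at least 1.\<close>
    also have "\<dots> \<le> real (h 2) * exp (C * R) + (8 * M + 4 * real (h 2)) * exp (C * R)"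
      using mult_mono[OF h2 E] by simp
    \<comment> \<open>The coefficients are now 8 for \<open>M\<close> and 5 for \<open>h 2\<close>,
      so a common factor 8 covers both; the summand 8 in \<open>C + 8\<close> then absorbs it, as
      \<open>R \<ge> 1\<close>.\<close>
    also have "\<dots> \<le> (M + real (h 2) ^ 3 / real q + real (h 2)) * (8 * exp (C * R))"
      using E h2 M by (simp add: algebra_simps)
    also have "\<dots> \<le> (M + real (h 2) ^ 3 / real q + real (h 2)) * exp ((C + 8) * R)"
    proof (rule mult_left_mono)
      have "8 \<le> exp (8 * R)" using exp_ge_add_one_self[of "8 * R"] R by linarith
      then show "8 * exp (C * R) \<le> exp ((C + 8) * R)" by (simp add: algebra_simps exp_add)
    qed (use M h2 in auto)
    finally show ?thesis by (simp add: M_def R_def)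
  qed
  then show ?thesis using C by (intro exI[of _ "C + 8"]) auto
qed

end
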